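(* Let $R'=R[\![\mathbf{u}^{s_1},\mathbf{u}^{s_2},\mathbf{u}^{s_3}]\!]$ be a flat rectangular numerical semigroup algebra over $R$ whose minimal monomials are $\mathbf{u}^{s_1},\mathbf{u}^{s_2},\mathbf{u}^{s_3}$, and let its Apéry monomials form a rectangle of size $\beta_1\times\beta_2\times\beta_3$. Then the associated $3\times 3$ matrix $\log_{\mathbf{Y}}\mathbf{Z}$ is triangular after a suitable permutation of the indices $\{1,2,3\}$ (applied simultaneously to rows and columns). In particular, $\log_{\mathbf{Y}}\mathbf{Z}$ is non-singular.
   Context: Let $\kappa$ be a field. A numerical semigroup is a monoid $S$ (under addition) generated by finitely many (at least one) positive rational numbers. The numerical semigroup ring $\kappa[\![\mathbf{u}^S]\!]$ consists of all power series $\sum_{s\in S}a_s\mathbf{u}^s$ with $a_s\in\kappa$; the elements $\mathbf{u}^s$ ($s\in S$) are its monomials. For numerical semigroups $S\subset S'$, put $R=\kappa[\![\mathbf{u}^S]\!]$ and $R'=\kappa[\![\mathbf{u}^{S'}]\!]$; then $R'$ is an $R$-algebra via inclusion, denoted $R'/R$ and called a numerical semigroup algebra. If $S'$ is generated by $S$ together with $s_1,\ldots,s_n$, one writes $R'=R[\![\mathbf{u}^{s_1},\ldots,\mathbf{u}^{s_n}]\!]$. The algebra is flat if $R'$ is a flat $R$-module. A monomial $p$ of $R'$ is an Apéry monomial of $R'/R$ if, whenever $p=p_1p_2$ with $p_1$ a monomial of $R$ and $p_2$ a monomial of $R'$, then $p_1=1$. An Apéry monomial $p\neq 1$ is a minimal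 monomial if, whenever $p=p_1p_2$ with $p_1,p_2$ monomials of $R'$, one of $p_1,p_2$ equals $p$. Let $\mathbf{u}^{s_1},\ldots,\mathbf{u}^{s_n}$ be the (distinct) minimal monomials of $R'/R$. The set of Apéry monomials is called a rectangle of size $\beta_1\times\cdots\times\beta_n$ (for positive integers $\beta_i$) if every Apéry monomial can be written uniquely as $(\mathbf{u}^{s_1})^{\ell_1}\cdots(\mathbf{u}^{s_n})^{\ell_n}$ with integers $0\le\ell_i<\beta_i$, and every monomial $(\mathbf{u}^{s_1})^{\ell_1}\cdots(\mathbf{u}^{s_n})^{\ell_n}$ with $0\le\ell_i<\beta_i$ is Apéry. The algebra is rectangular if its Apéry monomials form a rectangle of some size. If $R'/R$ is flat and its Apéry monomials form a rectangle of size $\beta_1\times\cdots\times\beta_n$, then for each $i$ there is a unique factorization $\mathbf{u}^{s_i\beta_i}=\mathbf{u}^{t_i}(\mathbf{u}^{s_1})^{\beta_{i1}}\cdots(\mathbf{u}^{s_n})^{\beta_{in}}$ with $\mathbf{u}^{t_i}\in R$ and integers $0\le\beta_{ij}<\beta_j$ for all $j$; here $\beta_{ii}=0$. The matrix $\log_{\mathbf{Y}}\mathbf{Z}$ is the $n\times n$ matrix with diagonal entries $\beta_1,\ldots,\beta_n$ and $(i,j)$ entry $-\beta_{ij}$ for $i\neq j$. *)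

theory Defs
  imports
    "HOL-Algebra.Free_Abelian_Groups"
    "HOL-Algebra.Module"
    "HOL-Analysis.Determinants"
begin

section \<open>Tensor products and flat modules\<close>

text \<open>
  The tensor product of two modules is the free abelian group on pairs modulo the subgroup
  generated by the bilinearity relations. Only its underlying abelian group is needed for
  flatness; it is written multiplicatively, as HOL-Algebra does for free abelian groups.
\<close>

abbreviation tensor_free ::
  "('m, 'c) partial_object_scheme \<Rightarrow> ('f, 'd) partial_object_scheme \<Rightarrow> ('m \<times> 'f \<Rightarrow>\<^sub>0 int) monoid"
  where "tensor_free M F \<equiv> free_Abelian_group (carrier M \<times> carrier F)"

definition tensor_relators ::
  "('a, 'b) ring_scheme \<Rightarrow> ('a, 'm, 'c) module_scheme \<Rightarrow> ('a, 'f, 'd) module_scheme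
    \<Rightarrow> ('m \<times> 'f \<Rightarrow>\<^sub>0 int) set"
  where
  "tensor_relators R M F =
     {frag_of (x \<oplus>\<^bsub>M\<^esub> x', y) - frag_of (x, y) - frag_of (x', y) | x x' y.
        x \<in> carrier M \<and> x' \<in> carrier M \<and> y \<in> carrier F} \<union>
     {frag_of (x, y \<oplus>\<^bsub>F\<^esub> y') - frag_of (x, y) - frag_of (x, y') | x y y'.
        x \<in> carrier M \<and> y \<in> carrier F \<and> y' \<in> carrier F} \<union>
     {frag_of (a \<odot>\<^bsub>M\<^esub> x, y) - frag_of (x, a \<odot>\<^bsub>F\<^esub> y) | a x y.
        a \<in> carrier R \<and> x \<in> carrier M \<and> y \<in> carrier F}"

definition tensor_null ::
  "('a, 'b) ring_scheme \<Rightarrow> ('a, 'm, 'c) module_scheme \<Rightarrow> ('a, 'f, 'd) module_scheme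
    \<Rightarrow> ('m \<times> 'f \<Rightarrow>\<^sub>0 int) set"
  where "tensor_null R M F = generate (tensor_free M F) (tensor_relators R M F)"

definition tensor ::
  "('a, 'b) ring_scheme \<Rightarrow> ('a, 'm, 'c) module_scheme \<Rightarrow> ('a, 'f, 'd) module_scheme
    \<Rightarrow> ('m \<times> 'f \<Rightarrow>\<^sub>0 int) set monoid"
  where "tensor R M F = tensor_free M F Mod tensor_null R M F"

definition module_homs ::
  "('a, 'b) ring_scheme \<Rightarrow> ('a, 'm, 'c) module_scheme \<Rightarrow> ('a, 'n, 'd) module_scheme
    \<Rightarrow> ('m \<Rightarrow> 'n) set"
  where
  "module_homs R M N =
     {f. f \<in> carrier M \<rightarrow> carrier N \<and>
         (\<forall>x\<in>carrier M. \<forall>y\<in>carrier M. f (x \<oplus>\<^bsub>M\<^esub> y) = f x \<oplus>\<^bsub>N\<^esub> f y) \<and>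
         (\<forall>a\<in>carrier R. \<forall>x\<in>carrier M. f (a \<odot>\<^bsub>M\<^esub> x) = a \<odot>\<^bsub>N\<^esub> f x)}"

text \<open>
  The map induced by \<open>f\<close> on tensor products with \<open>F\<close>: a coset \<open>C\<close> is sent to the coset
  containing the image of \<open>C\<close> under the map of free abelian groups
  given on generators by \<open>(x, y) \<mapsto> (f x, y)\<close>.
\<close>

definition tensor_map ::
  "('a, 'b) ring_scheme \<Rightarrow> ('a, 'n, 'c) module_scheme \<Rightarrow> ('a, 'f, 'd) module_scheme
    \<Rightarrow> ('m \<Rightarrow> 'n) \<Rightarrow> ('m \<times> 'f \<Rightarrow>\<^sub>0 int) set \<Rightarrow> ('n \<times> 'f \<Rightarrow>\<^sub>0 int) set"
  where
  "tensor_map R N F f C =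
     tensor_null R N F <#>\<^bsub>tensor_free N F\<^esub> frag_extend (\<lambda>(x, y). frag_of (f x, y)) ` C"

text \<open>
  \<open>F\<close> is flat if tensoring with \<open>F\<close> preserves injectivity of module homomorphisms. HOL cannot
  quantify over types inside a definition, so the test modules live in the fixed type
  \<open>(nat \<Rightarrow> 'a) set\<close>. It contains, up to isomorphism, all finitely generated \<open>R\<close>-modules (a quotient
  of a free module of rank \<open>n\<close> consists of sets of functions supported on \<open>{..<n}\<close>), in particular
  \<open>R\<close> and its finitely generated ideals, and indeed every module of at most the cardinality of this type,
  in particular all ideals. As flatness is detected already by the injections of
  (finitely generated) ideals into \<open>R\<close>, the restriction does not change the notion.
\<close>

definition flat_module :: "('a, 'b) ring_scheme \<Rightarrow> ('a, 'f, 'd) module_scheme \<Rightarrow> bool"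
  where
  "flat_module R F \<longleftrightarrow>
     Module.module R F \<and>
     (\<forall>(M :: ('a, (nat \<Rightarrow> 'a) set) module) (N :: ('a, (nat \<Rightarrow> 'a) set) module) f.
        Module.module R M \<and> Module.module R N \<and> f \<in> module_homs R M N \<and> inj_on f (carrier M)
        \<longrightarrow> inj_on (tensor_map R N F f) (carrier (tensor R M F)))"

section \<open>Numerical semigroups and their rings\<close>

inductive_set monoid_span :: "rat set \<Rightarrow> rat set" for G :: "rat set"
  where
    zero: "0 \<in> monoid_span G"
  | incl: "g \<in> G \<Longrightarrow> g \<in> monoid_span G"
  | add: "a \<in> monoid_span G \<Longrightarrow> b \<in> monoid_span G \<Longrightarrow> a + b \<in> monoid_span G"

definition numerical_semigroup :: "rat set \<Rightarrow> bool"
  where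
  "numerical_semigroup S \<longleftrightarrow>
     (\<exists>G. finite G \<and> G \<noteq> {} \<and> (\<forall>g\<in>G. 0 < g) \<and> S = monoid_span G)"

text \<open>
  A power series is represented by its coefficient function, vanishing outside \<open>S\<close>. The sum
  defining the product is finite when \<open>S\<close> is a numerical semigroup, since \<open>S\<close> then has only
  finitely many elements below any bound.
\<close>

definition semigroup_ring :: "rat set \<Rightarrow> (rat \<Rightarrow> 'k::field) ring"
  where
  "semigroup_ring S =
     \<lparr>carrier = {f. \<forall>x. x \<notin> S \<longrightarrow> f x = 0},
      monoid.mult = (\<lambda>f g x. \<Sum>s | s \<in> S \<and> x - s \<in> S. f s * g (x - s)),
      one = (\<lambda>x. if x = 0 then 1 else 0),
      zero = (\<lambda>x. 0),
      add = (\<lambda>f g x. f x + g x)\<rparr>"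

text \<open>The ring of \<open>S'\<close> as a module over the ring of a smaller semigroup, via inclusion.\<close>

definition semigroup_algebra :: "rat set \<Rightarrow> (rat \<Rightarrow> 'k::field, rat \<Rightarrow> 'k) module"
  where
  "semigroup_algebra S' =
     \<lparr>carrier = carrier (semigroup_ring S'),
      monoid.mult = monoid.mult (semigroup_ring S'),
      one = one (semigroup_ring S'),
      zero = zero (semigroup_ring S'),
      add = add (semigroup_ring S'),
      smult = monoid.mult (semigroup_ring S')\<rparr>"

definition umonom :: "rat \<Rightarrow> rat \<Rightarrow> 'k::field"
  where "umonom s = (\<lambda>x. if x = s then 1 else 0)"

definition monomials :: "rat set \<Rightarrow> (rat \<Rightarrow> 'k::field) set"
  where "monomials S = umonom ` S"

section \<open>Apery monomials, minimal monomials and rectangles\<close>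

text \<open>In the following, \<open>S \<subseteq> S'\<close> are the semigroups of the algebra \<open>R'/R\<close>.\<close>

definition apery_monomials :: "rat set \<Rightarrow> rat set \<Rightarrow> (rat \<Rightarrow> 'k::field) set"
  where
  "apery_monomials S S' =
     {p \<in> monomials S'. \<forall>p1\<in>monomials S. \<forall>p2\<in>monomials S'.
        p = p1 \<otimes>\<^bsub>semigroup_ring S'\<^esub> p2 \<longrightarrow> p1 = \<one>\<^bsub>semigroup_ring S'\<^esub>}"

definition minimal_monomials :: "rat set \<Rightarrow> rat set \<Rightarrow> (rat \<Rightarrow> 'k::field) set"
  where
  "minimal_monomials S S' =
     {p \<in> apery_monomials S S'. p \<noteq> \<one>\<^bsub>semigroup_ring S'\<^esub> \<and>
        (\<forall>p1\<in>monomials S'. \<forall>p2\<in>monomials S'.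
           p = p1 \<otimes>\<^bsub>semigroup_ring S'\<^esub> p2 \<longrightarrow> p1 = p \<or> p2 = p)}"

text \<open>The index set \<open>{1, \<dots>, n}\<close> is a finite type \<open>'n\<close>.\<close>

definition monomial_product :: "rat set \<Rightarrow> ('n::finite \<Rightarrow> rat) \<Rightarrow> ('n \<Rightarrow> nat) \<Rightarrow> rat \<Rightarrow> 'k::field"
  where
  "monomial_product S' s l =
     (\<Otimes>\<^bsub>semigroup_ring S'\<^esub>i\<in>UNIV. umonom (s i) [^]\<^bsub>semigroup_ring S'\<^esub> l i)"

definition apery_rectangle ::
  "'k::field itself \<Rightarrow> rat set \<Rightarrow> rat set \<Rightarrow> ('n::finite \<Rightarrow> rat) \<Rightarrow> ('n \<Rightarrow> nat) \<Rightarrow> bool"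
  where
  "apery_rectangle TYPE('k) S S' s \<beta> \<longleftrightarrow>
     (\<forall>i. 0 < \<beta> i) \<and>
     (\<forall>p \<in> (apery_monomials S S' :: (rat \<Rightarrow> 'k) set).
        \<exists>!l. (\<forall>i. l i < \<beta> i) \<and> p = monomial_product S' s l) \<and>
     (\<forall>l. (\<forall>i. l i < \<beta> i) \<longrightarrow>
        monomial_product S' s l \<in> (apery_monomials S S' :: (rat \<Rightarrow> 'k) set))"

text \<open>
  The exponents \<open>\<beta>\<^sub>i\<^sub>j\<close> (indexed by \<open>j\<close>) in the factorization of \<open>u^(s\<^sub>i \<beta>\<^sub>i)\<close> into a monomial of \<open>R\<close>
  and a monomial in the rectangle. They exist and are unique for flat rectangular algebras.
\<close>

definition log_exponents ::
  "'k::field itself \<Rightarrow> rat set \<Rightarrow> rat set \<Rightarrow> ('n::finite \<Rightarrow> rat) \<Rightarrow> ('n \<Rightarrow> nat) \<Rightarrow> 'n \<Rightarrow> 'n \<Rightarrow> nat"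
  where
  "log_exponents TYPE('k) S S' s \<beta> i =
     (THE b. (\<forall>j. b j < \<beta> j) \<and>
        (\<exists>t\<in>S. (umonom (s i * of_nat (\<beta> i)) :: rat \<Rightarrow> 'k) =
           umonom t \<otimes>\<^bsub>semigroup_ring S'\<^esub> monomial_product S' s b))"

definition log_matrix ::
  "'k::field itself \<Rightarrow> rat set \<Rightarrow> rat set \<Rightarrow> ('n::finite \<Rightarrow> rat) \<Rightarrow> ('n \<Rightarrow> nat) \<Rightarrow> int ^ 'n ^ 'n"
  where
  "log_matrix TYPE('k) S S' s \<beta> =
     (\<chi> i j. if i = j then int (\<beta> i) else - int (log_exponents TYPE('k) S S' s \<beta> i j))"

definition triangular :: "'a::zero ^ ('n::{finite, linorder}) ^ ('n::{finite, linorder}) \<Rightarrow> bool"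
  where
  "triangular A \<longleftrightarrow> (\<forall>i j. j < i \<longrightarrow> A $ i $ j = 0) \<or> (\<forall>i j. i < j \<longrightarrow> A $ i $ j = 0)"

end

theory Submission
  imports Defs
begin

text \<open>
  Flatness makes the decomposition of an element of \<open>S'\<close> into an element of \<open>S\<close> and an Apery element
  unique: otherwise \<open>u\<^sup>t \<otimes> u\<^sup>a\<close> and \<open>u\<^sup>t' \<otimes> u\<^sup>a'\<close> are different tensors over an ideal that become equal
  over the whole ring.

  Draw an edge from \<open>i\<close> to \<open>j\<close> if \<open>\<beta>\<^sub>i\<^sub>j > 0\<close>. If every column has a non-zero off-diagonal entry, then
  the sum of the three factorizations equates two elements of the rectangle up to an element of
  \<open>S\<close>. By uniqueness all \<open>t\<^sub>i\<close> vanish and \<open>\<beta>\<^sub>j\<close> is the sum of the other two entries of its column, as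
  in Herzog's description of non-symmetric semigroups with three generators. In that case
  \<open>x = \<beta>\<^sub>1 s\<^sub>1 + \<beta>\<^sub>3\<^sub>2 s\<^sub>2\<close> and \<open>y = \<beta>\<^sub>1 s\<^sub>1 + \<beta>\<^sub>2\<^sub>3 s\<^sub>3\<close> both lie in \<open>S\<close>, and \<open>x + \<beta>\<^sub>2\<^sub>3 s\<^sub>3 = y + \<beta>\<^sub>3\<^sub>2 s\<^sub>2\<close>
  contradicts uniqueness. So some vertex has no incoming edge, and the same summation over the
  other two indices excludes a cycle between them.
\<close>

section \<open>Tensor products\<close>

lemma tensor_relators_carrier:
  assumes "Module.module R M" "Module.module R F"
  shows "tensor_relators R M F \<subseteq> carrier (tensor_free M F)"
proof -
  interpret M: Module.module R M by fact
  interpret F: Module.module R F by fact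
  show ?thesis
    unfolding tensor_relators_def
    by (auto simp: keys_frag_of dest!: keys_diff[THEN subsetD])
qed

lemma subgroup_tensor_null:
  assumes "Module.module R M" "Module.module R F"
  shows "subgroup (tensor_null R M F) (tensor_free M F)"
  unfolding tensor_null_def
  by (rule group.generate_is_subgroup[OF group_free_Abelian_group tensor_relators_carrier[OF assms]])

lemma tensor_null_induct [consumes 3, case_names zero relator minus add]:
  assumes "Module.module R M" "Module.module R F" "c \<in> tensor_null R M F"
    and "P 0" "\<And>r. r \<in> tensor_relators R M F \<Longrightarrow> P r" "\<And>a. P a \<Longrightarrow> P (- a)"
    and "\<And>a b. P a \<Longrightarrow> P b \<Longrightarrow> P (a + b)"
  shows "P c"
  using assms(3) unfolding tensor_null_def
proof (induction rule: generate.induct)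
  case (inv h)
  \<comment> \<open>The group inverse is known to be negation only for elements of the
    carrier.\<close>
  then have "h \<in> carrier (tensor_free M F)"
    using tensor_relators_carrier[OF assms(1,2)] by blast
  then show ?case
    using inv assms(5,6) by simp
qed (use assms in auto)

lemma tensor_null_closed:
  assumes "Module.module R M" "Module.module R F"
  shows "0 \<in> tensor_null R M F"
    and "a \<in> tensor_null R M F \<Longrightarrow> b \<in> tensor_null R M F \<Longrightarrow> a + b \<in> tensor_null R M F"
    and "a \<in> tensor_null R M F \<Longrightarrow> - a \<in> tensor_null R M F"
    and "a \<in> tensor_null R M F \<Longrightarrow> b \<in> tensor_null R M F \<Longrightarrow> a - b \<in> tensor_null R M F"
    and "r \<in> tensor_relators R M F \<Longrightarrow> r \<in> tensor_null R M F"
proof -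
  interpret subgroup "tensor_null R M F" "tensor_free M F"
    by (rule subgroup_tensor_null[OF assms])
  show *: "0 \<in> tensor_null R M F"
    "a \<in> tensor_null R M F \<Longrightarrow> b \<in> tensor_null R M F \<Longrightarrow> a + b \<in> tensor_null R M F"
    for a b
    using one_closed m_closed by auto
  show **: "- a \<in> tensor_null R M F" if a: "a \<in> tensor_null R M F" for a
  proof -
    have "a \<in> carrier (tensor_free M F)"
      using a subset by blast
    then show ?thesis
      using m_inv_closed[OF a] by simp
  qed
  show "a \<in> tensor_null R M F \<Longrightarrow> b \<in> tensor_null R M F \<Longrightarrow> a - b \<in> tensor_null R M F"
    using *(2)[of a "- b"] ** by simp
  show "r \<in> tensor_relators R M F \<Longrightarrow> r \<in> tensor_null R M F"
    by (simp add: tensor_null_def generate.incl)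
qed

text \<open>Linearity of \<open>f\<close> turns each relator into a relator of the same kind; the
  rest is additivity.\<close>

lemma tensor_null_image:
  assumes "Module.module R M" "Module.module R N" "Module.module R F" "f \<in> module_homs R M N"
    and "c \<in> tensor_null R M F"
  shows "frag_extend (\<lambda>(x, y). frag_of (f x, y)) c \<in> tensor_null R N F"
  using assms(1,3,5)
proof (induction rule: tensor_null_induct)
  case (relator r)
  interpret M: Module.module R M by fact
  have f: "f x \<in> carrier N" "f (x \<oplus>\<^bsub>M\<^esub> y) = f x \<oplus>\<^bsub>N\<^esub> f y"
    "a \<in> carrier R \<Longrightarrow> f (a \<odot>\<^bsub>M\<^esub> x) = a \<odot>\<^bsub>N\<^esub> f x"
    if "x \<in> carrier M" "y \<in> carrier M" for a x y
    using assms(4) that by (auto simp: module_homs_def)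
  let ?f = "frag_extend (\<lambda>(x, y). frag_of (f x, y))"
  from relator consider
    x x' y where "x \<in> carrier M" "x' \<in> carrier M" "y \<in> carrier F"
      "r = frag_of (x \<oplus>\<^bsub>M\<^esub> x', y) - frag_of (x, y) - frag_of (x', y)"
  | x y y' where "x \<in> carrier M" "y \<in> carrier F" "y' \<in> carrier F"
      "r = frag_of (x, y \<oplus>\<^bsub>F\<^esub> y') - frag_of (x, y) - frag_of (x, y')"
  | a x y where "a \<in> carrier R" "x \<in> carrier M" "y \<in> carrier F"
      "r = frag_of (a \<odot>\<^bsub>M\<^esub> x, y) - frag_of (x, a \<odot>\<^bsub>F\<^esub> y)"
    unfolding tensor_relators_def by blast
  then have "?f r \<in> tensor_relators R N F"
  proof cases
    case 1
    then have "?f r = frag_of (f x \<oplus>\<^bsub>N\<^esub> f x', y) - frag_of (f x, y) - frag_of (f x', y)"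
      by (simp add: frag_extend_diff f)
    with 1 f show ?thesis
      unfolding tensor_relators_def by blast
  next
    case 2
    then have "?f r = frag_of (f x, y \<oplus>\<^bsub>F\<^esub> y') - frag_of (f x, y) - frag_of (f x, y')"
      by (simp add: frag_extend_diff f)
    with 2 f show ?thesis
      unfolding tensor_relators_def by blast
  next
    case 3
    then have "?f r = frag_of (a \<odot>\<^bsub>N\<^esub> f x, y) - frag_of (f x, a \<odot>\<^bsub>F\<^esub> y)"
      by (simp add: frag_extend_diff f)
    with 3 f show ?thesis
      unfolding tensor_relators_def by blast
  qed
  then show ?case
    by (rule tensor_null_closed(5)[OF assms(2,3)])
qed (simp_all add: frag_extend_minus frag_extend_add tensor_null_closed[OF assms(2,3)])

text \<open>Another representative changes the image only by an element of
  \<open>frag_extend\<close> applied to \<open>tensor_null R M F\<close>, which the null subgroup of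
  the target absorbs. So the set product in \<open>tensor_map\<close> is a single coset.\<close>

lemma tensor_map_coset:
  assumes "Module.module R M" "Module.module R N" "Module.module R F" "f \<in> module_homs R M N"
  shows "tensor_map R N F f (tensor_null R M F #>\<^bsub>tensor_free M F\<^esub> c)
    = tensor_null R N F #>\<^bsub>tensor_free N F\<^esub> frag_extend (\<lambda>(x, y). frag_of (f x, y)) c"
proof -
  let ?f = "frag_extend (\<lambda>(x, y). frag_of (f x, y))"
  show ?thesis
  proof (intro equalityI subsetI)
    fix z assume "z \<in> tensor_map R N F f (tensor_null R M F #>\<^bsub>tensor_free M F\<^esub> c)"
    then obtain n m where "n \<in> tensor_null R N F" "m \<in> tensor_null R M F" "z = n + ?f (m + c)"
      unfolding tensor_map_def set_mult_def r_coset_def by auto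
    then have "n + ?f m \<in> tensor_null R N F" "z = (n + ?f m) + ?f c"
      using tensor_null_image[OF assms] tensor_null_closed(2)[OF assms(2,3)]
      by (auto simp: frag_extend_add)
    then show "z \<in> tensor_null R N F #>\<^bsub>tensor_free N F\<^esub> ?f c"
      unfolding r_coset_def by auto
  next
    fix z assume "z \<in> tensor_null R N F #>\<^bsub>tensor_free N F\<^esub> ?f c"
    \<comment> \<open>The summand 0 presents \<open>c\<close> as a member of its own coset.\<close>
    then obtain n where "n \<in> tensor_null R N F" "z = n + ?f (0 + c)"
      unfolding r_coset_def by auto
    then show "z \<in> tensor_map R N F f (tensor_null R M F #>\<^bsub>tensor_free M F\<^esub> c)"
      unfolding tensor_map_def set_mult_def r_coset_def
      using tensor_null_closed(1)[OF assms(1,3)] by fastforce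
  qed
qed

text \<open>Injectivity on cosets, unfolded to elements: \<open>c\<close> and 0 have the same image
  coset, hence the same coset.\<close>

lemma flat_module_tensor_null:
  fixes M N :: "('a, (nat \<Rightarrow> 'a) set) module"
  assumes flat: "flat_module R F"
    and mods: "Module.module R M" "Module.module R N" and f: "f \<in> module_homs R M N" "inj_on f (carrier M)"
    and c: "Poly_Mapping.keys c \<subseteq> carrier M \<times> carrier F"
    and null: "frag_extend (\<lambda>(x, y). frag_of (f x, y)) c \<in> tensor_null R N F"
  shows "c \<in> tensor_null R M F"
proof -
  let ?G = "tensor_free M F" and ?H = "tensor_free N F"
  have F: "Module.module R F" and inj: "inj_on (tensor_map R N F f) (carrier (tensor R M F))"
    using flat mods f unfolding flat_module_def by auto
  interpret HM: subgroup "tensor_null R M F" ?G by (rule subgroup_tensor_null[OF mods(1) F])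
  interpret HN: subgroup "tensor_null R N F" ?H by (rule subgroup_tensor_null[OF mods(2) F])
  interpret GM: group ?G by simp
  interpret GN: group ?H by simp
  have coset_in: "tensor_null R M F #>\<^bsub>?G\<^esub> d \<in> carrier (tensor R M F)"
    if "d \<in> carrier ?G" for d
    using that by (auto simp: tensor_def FactGroup_def RCOSETS_def)
  have "tensor_map R N F f (tensor_null R M F #>\<^bsub>?G\<^esub> c)
      = tensor_map R N F f (tensor_null R M F #>\<^bsub>?G\<^esub> 0)"
    using HN.rcos_const[OF GN.is_group null] HN.rcos_const[OF GN.is_group tensor_null_closed(1)[OF mods(2) F]]
    by (simp add: tensor_map_coset[OF mods F f(1)])
  then have "tensor_null R M F #>\<^bsub>?G\<^esub> c = tensor_null R M F #>\<^bsub>?G\<^esub> 0"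
    using inj coset_in[of c] coset_in[of 0] c by (simp add: inj_on_def)
  then show ?thesis
    using c GM.coset_join1[of "tensor_null R M F" c] HM.subgroup_axioms HM.subset
      HM.rcos_const[OF GM.is_group tensor_null_closed(1)[OF mods(1) F]] by simp
qed

section \<open>Balanced maps on tensor products\<close>

lemma sum_keys_add:
  fixes a b :: "'a \<Rightarrow>\<^sub>0 int" and \<phi> :: "'a \<Rightarrow> 'b::ring_1"
  defines "\<Phi> \<equiv> \<lambda>c. \<Sum>p\<in>Poly_Mapping.keys c. of_int (Poly_Mapping.lookup c p) * \<phi> p"
  shows "\<Phi> (a + b) = \<Phi> a + \<Phi> b"
proof -
  let ?K = "Poly_Mapping.keys a \<union> Poly_Mapping.keys b"
  \<comment> \<open>Over the union of both supports the sums become comparable; the added terms have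
    coefficient 0.\<close>
  have ext: "\<Phi> c = (\<Sum>p\<in>?K. of_int (Poly_Mapping.lookup c p) * \<phi> p)" if "Poly_Mapping.keys c \<subseteq> ?K" for c
    unfolding \<Phi>_def by (rule sum.mono_neutral_left) (use that in \<open>auto simp: in_keys_iff\<close>)
  show ?thesis
    using Poly_Mapping.keys_add[of a b]
    by (simp add: ext lookup_add sum.distrib distrib_right)
qed

text \<open>One half of the universal property, used to tell two tensors apart: the additive
  extension of a balanced map to the free group kills all relators.\<close>

lemma balanced_eq_if_tensor_null:
  fixes \<phi> :: "'m \<times> 'f \<Rightarrow> 'b::ring_1"
  assumes mods: "Module.module R M" "Module.module R F"
    and add1: "\<And>x x' y. x \<in> carrier M \<Longrightarrow> x' \<in> carrier M \<Longrightarrow> y \<in> carrier F \<Longrightarrow>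
      \<phi> (x \<oplus>\<^bsub>M\<^esub> x', y) = \<phi> (x, y) + \<phi> (x', y)"
    and add2: "\<And>x y y'. x \<in> carrier M \<Longrightarrow> y \<in> carrier F \<Longrightarrow> y' \<in> carrier F \<Longrightarrow>
      \<phi> (x, y \<oplus>\<^bsub>F\<^esub> y') = \<phi> (x, y) + \<phi> (x, y')"
    and balanced: "\<And>a x y. a \<in> carrier R \<Longrightarrow> x \<in> carrier M \<Longrightarrow> y \<in> carrier F \<Longrightarrow>
      \<phi> (a \<odot>\<^bsub>M\<^esub> x, y) = \<phi> (x, a \<odot>\<^bsub>F\<^esub> y)"
    and null: "frag_of p - frag_of q \<in> tensor_null R M F"
  shows "\<phi> p = \<phi> q"
proof -
  define \<Phi> where "\<Phi> c = (\<Sum>p\<in>Poly_Mapping.keys c. of_int (Poly_Mapping.lookup c p) * \<phi> p)" for c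
  have \<Phi>_add: "\<Phi> (a + b) = \<Phi> a + \<Phi> b" for a b
    unfolding \<Phi>_def by (rule sum_keys_add)
  have \<Phi>_0: "\<Phi> 0 = 0"
    by (simp add: \<Phi>_def)
  have \<Phi>_minus: "\<Phi> (- a) = - \<Phi> a" for a
    using \<Phi>_add[of a "- a"] \<Phi>_0 by (simp add: eq_neg_iff_add_eq_0 add.commute)
  have \<Phi>_diff: "\<Phi> (a - b) = \<Phi> a - \<Phi> b" for a b
    using \<Phi>_add[of a "- b"] \<Phi>_minus[of b] by simp
  have \<Phi>_of: "\<Phi> (frag_of p) = \<phi> p" for p
    by (simp add: \<Phi>_def)
  have "\<Phi> c = 0" if "c \<in> tensor_null R M F" for c
    using mods that
  proof (induction rule: tensor_null_induct)
    case (relator r)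
    then show ?case
      by (auto simp: tensor_relators_def \<Phi>_diff \<Phi>_of add1 add2 balanced)
  qed (simp_all add: \<Phi>_0 \<Phi>_minus \<Phi>_add)
  from this[OF null] show ?thesis
    by (simp add: \<Phi>_diff \<Phi>_of)
qed

section \<open>Numerical semigroups\<close>

lemma numerical_semigroup_zero: "numerical_semigroup S \<Longrightarrow> 0 \<in> S"
  by (auto simp: numerical_semigroup_def monoid_span.zero)

lemma numerical_semigroup_add:
  "numerical_semigroup S \<Longrightarrow> a \<in> S \<Longrightarrow> b \<in> S \<Longrightarrow> a + b \<in> S"
  by (auto simp: numerical_semigroup_def monoid_span.add)

text \<open>The smallest generator serves as the gap. It later bounds the length of the descent to
  an Apery element.\<close>

lemma numerical_semigroup_gap:
  assumes "numerical_semigroup S"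
  obtains \<delta> where "0 < \<delta>" "\<And>a. a \<in> S \<Longrightarrow> a = 0 \<or> \<delta> \<le> a"
proof -
  obtain G where G: "finite G" "G \<noteq> {}" "\<And>g. g \<in> G \<Longrightarrow> 0 < g" "S = monoid_span G"
    using assms by (auto simp: numerical_semigroup_def)
  have pos: "0 < Min G"
    using G by simp
  moreover have "a = 0 \<or> Min G \<le> a" if "a \<in> S" for a
    using that unfolding G(4)
  proof induction
    case (incl g)
    then show ?case
      using G(1) by simp
  next
    case (add a b)
    then show ?case
      using pos by linarith
  qed simp
  ultimately show ?thesis
    by (rule that)
qed

lemma numerical_semigroup_nonneg:
  assumes "numerical_semigroup S" "a \<in> S"
  shows "0 \<le> a"
proof -
  obtain \<delta> where "0 < \<delta>" "a = 0 \<or> \<delta> \<le> a"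
    using numerical_semigroup_gap[OF assms(1)] assms(2) by metis
  then show ?thesis
    by linarith
qed

text \<open>Elements are combinations of the generators with natural coefficients, and in an element
  up to \<open>x\<close> the coefficient of \<open>g\<close> is at most
  \<open>x / g\<close>.\<close>

lemma finite_numerical_semigroup_atMost:
  assumes "numerical_semigroup S"
  shows "finite {a \<in> S. a \<le> x}"
proof -
  obtain G where G: "finite G" "\<And>g. g \<in> G \<Longrightarrow> 0 < g" "S = monoid_span G"
    using assms by (auto simp: numerical_semigroup_def)
  have rep: "\<exists>n. a = (\<Sum>g\<in>G. of_nat (n g) * g)" if "a \<in> S" for a
    using that unfolding G(3)
  proof induction
    case zero
    then show ?case by (intro exI[of _ "\<lambda>_. 0"]) simp
  next
    case (incl g)
    have "(\<Sum>h\<in>G. of_nat (if h = g then 1 else 0) * h) = (\<Sum>h\<in>G. if h = g then h else 0)"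
      by (rule sum.cong) auto
    with incl G(1) show ?case
      by (intro exI[of _ "\<lambda>h. if h = g then 1 else 0"]) simp
  next
    case (add a b)
    then obtain m n where "a = (\<Sum>g\<in>G. of_nat (m g) * g)" "b = (\<Sum>g\<in>G. of_nat (n g) * g)"
      by blast
    then show ?case
      by (intro exI[of _ "\<lambda>g. m g + n g"]) (simp add: sum.distrib distrib_right)
  qed
  let ?B = "\<lambda>g. {..nat \<lfloor>x / g\<rfloor>}"
  have "{a \<in> S. a \<le> x} \<subseteq> (\<lambda>n. \<Sum>g\<in>G. of_nat (n g) * g) ` (Pi\<^sub>E G ?B)"
  proof
    fix a assume a: "a \<in> {a \<in> S. a \<le> x}"
    then obtain n where n: "a = (\<Sum>g\<in>G. of_nat (n g) * g)"
      using rep by blast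
    have "n g \<le> nat \<lfloor>x / g\<rfloor>" if "g \<in> G" for g
    proof -
      have "of_nat (n g) * g \<le> (\<Sum>g\<in>G. of_nat (n g) * g)"
        using that G(1,2) by (intro member_le_sum) (auto simp: less_imp_le)
      also have "\<dots> \<le> x"
        using a n by simp
      finally have "of_nat (n g) \<le> x / g"
        using G(2)[OF that] by (simp add: pos_le_divide_eq)
      then show ?thesis
        by (simp add: le_nat_floor le_nat_iff le_floor_iff)
    qed
    then have "restrict n G \<in> Pi\<^sub>E G ?B" and "a = (\<Sum>g\<in>G. of_nat (restrict n G g) * g)"
      using n by (auto intro!: restrict_PiE_iff[THEN iffD2])
    then show "a \<in> (\<lambda>n. \<Sum>g\<in>G. of_nat (n g) * g) ` (Pi\<^sub>E G ?B)"
      by blast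
  qed
  moreover have "finite (Pi\<^sub>E G ?B)"
    using G(1) by (intro finite_PiE) auto
  ultimately show ?thesis
    using finite_surj by blast
qed

text \<open>Makes the convolution a genuine finite sum; over an infinite index set the sum would
  default to 0.\<close>

lemma finite_decompositions:
  assumes "numerical_semigroup S"
  shows "finite {a. a \<in> S \<and> x - a \<in> S}"
proof (rule finite_subset)
  show "{a. a \<in> S \<and> x - a \<in> S} \<subseteq> {a \<in> S. a \<le> x}"
    by (auto dest: numerical_semigroup_nonneg[OF assms])
qed (rule finite_numerical_semigroup_atMost[OF assms])

section \<open>Semigroup rings\<close>

lemma mult_eq_single:
  assumes "numerical_semigroup S" "a \<in> S" "x - a \<in> S"
    and "\<And>b. b \<in> S \<Longrightarrow> x - b \<in> S \<Longrightarrow> b \<noteq> a \<Longrightarrow> f b * g (x - b) = 0"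
  shows "(f \<otimes>\<^bsub>semigroup_ring S\<^esub> g) x = f a * g (x - a)"
proof -
  have "(\<Sum>b | b \<in> S \<and> x - b \<in> S. f b * g (x - b)) = (\<Sum>b\<in>{a}. f b * g (x - b))"
    by (rule sum.mono_neutral_right) (use assms finite_decompositions in auto)
  then show ?thesis
    by (simp add: semigroup_ring_def)
qed

lemma mult_outside:
  assumes "numerical_semigroup S" "x \<notin> S"
  shows "(f \<otimes>\<^bsub>semigroup_ring S\<^esub> g) x = 0"
proof -
  have empty: "{a. a \<in> S \<and> x - a \<in> S} = {}"
    using numerical_semigroup_add[OF assms(1)] assms(2) by force
  show ?thesis
    by (simp add: semigroup_ring_def empty del: Collect_empty_eq)
qed

lemma mult_assoc_semigroup_ring:
  assumes S: "numerical_semigroup S"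
  shows "f \<otimes>\<^bsub>semigroup_ring S\<^esub> g \<otimes>\<^bsub>semigroup_ring S\<^esub> h
    = f \<otimes>\<^bsub>semigroup_ring S\<^esub> (g \<otimes>\<^bsub>semigroup_ring S\<^esub> h)"
proof
  fix x
  let ?D = "\<lambda>x. {a. a \<in> S \<and> x - a \<in> S}"
  have "(\<Sum>a\<in>?D x. (\<Sum>c\<in>?D a. f c * g (a - c)) * h (x - a))
      = (\<Sum>(a, c)\<in>Sigma (?D x) ?D. f c * g (a - c) * h (x - a))"
    using finite_decompositions[OF S] by (simp add: sum_distrib_right sum.Sigma)
  also have "\<dots> = (\<Sum>(c, d)\<in>(SIGMA c:?D x. ?D (x - c)). f c * (g d * h (x - c - d)))"
  \<comment> \<open>In \<open>(a, c)\<close>, \<open>a\<close> is the joint exponent of the first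
    two factors and \<open>c\<close> that of the first; \<open>d = a - c\<close> belongs to the
    second.\<close>
  proof (rule sum.reindex_bij_witness[where i = "\<lambda>(c, d). (c + d, c)" and j = "\<lambda>(a, c). (c, a - c)"])
    fix p assume "p \<in> Sigma (?D x) ?D"
    then obtain a c where p: "p = (a, c)" "a \<in> S" "x - a \<in> S" "c \<in> S" "a - c \<in> S"
      by auto
    have "x - c = (x - a) + (a - c)"
      by simp
    then have "x - c \<in> S"
      using p numerical_semigroup_add[OF S] by metis
    then show "(case p of (a, c) \<Rightarrow> (c, a - c)) \<in> (SIGMA c:?D x. ?D (x - c))"
      using p by simp
  next
    fix p assume "p \<in> (SIGMA c:?D x. ?D (x - c))"
    then show "(case p of (c, d) \<Rightarrow> (c + d, c)) \<in> Sigma (?D x) ?D"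
      using numerical_semigroup_add[OF S] by (auto simp: diff_diff_eq)
  qed (auto simp: mult.assoc)
  also have "\<dots> = (\<Sum>c\<in>?D x. f c * (\<Sum>d\<in>?D (x - c). g d * h (x - c - d)))"
    using finite_decompositions[OF S] by (simp add: sum_distrib_left sum.Sigma)
  finally show "(f \<otimes>\<^bsub>semigroup_ring S\<^esub> g \<otimes>\<^bsub>semigroup_ring S\<^esub> h) x
      = (f \<otimes>\<^bsub>semigroup_ring S\<^esub> (g \<otimes>\<^bsub>semigroup_ring S\<^esub> h)) x"
    by (simp add: semigroup_ring_def)
qed

lemma one_mult_semigroup_ring:
  assumes "numerical_semigroup S" "f \<in> carrier (semigroup_ring S)"
  shows "\<one>\<^bsub>semigroup_ring S\<^esub> \<otimes>\<^bsub>semigroup_ring S\<^esub> f = f"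
proof
  fix x
  show "(\<one>\<^bsub>semigroup_ring S\<^esub> \<otimes>\<^bsub>semigroup_ring S\<^esub> f) x = f x"
  proof (cases "x \<in> S")
    case True
    then show ?thesis
      using assms(1) numerical_semigroup_zero[OF assms(1)]
      by (subst mult_eq_single[where a = 0]) (simp_all add: semigroup_ring_def)
  next
    case False
    then show ?thesis
      using assms by (simp add: mult_outside) (simp add: semigroup_ring_def)
  qed
qed

lemma mult_commute_semigroup_ring:
  "f \<otimes>\<^bsub>semigroup_ring S\<^esub> g = g \<otimes>\<^bsub>semigroup_ring S\<^esub> f"
proof
  fix x
  have "(\<Sum>a | a \<in> S \<and> x - a \<in> S. f a * g (x - a)) = (\<Sum>a | a \<in> S \<and> x - a \<in> S. g a * f (x - a))"
    by (rule sum.reindex_bij_witness[where i = "\<lambda>a. x - a" and j = "\<lambda>a. x - a"]) auto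
  then show "(f \<otimes>\<^bsub>semigroup_ring S\<^esub> g) x = (g \<otimes>\<^bsub>semigroup_ring S\<^esub> f) x"
    by (simp add: semigroup_ring_def)
qed

lemma comm_monoid_semigroup_ring:
  assumes S: "numerical_semigroup S"
  shows "comm_monoid (semigroup_ring S :: (rat \<Rightarrow> 'k::field) ring)"
proof (rule comm_monoidI)
  let ?R = "semigroup_ring S :: (rat \<Rightarrow> 'k) ring"
  show "f \<otimes>\<^bsub>?R\<^esub> g \<in> carrier ?R" for f g
  proof -
    have "carrier ?R = {f. \<forall>x. x \<notin> S \<longrightarrow> f x = 0}"
      by (simp add: semigroup_ring_def)
    then show ?thesis
      using mult_outside[OF S] by blast
  qed
  show "\<one>\<^bsub>?R\<^esub> \<in> carrier ?R"
    using numerical_semigroup_zero[OF S] by (auto simp: semigroup_ring_def)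
  show "f \<otimes>\<^bsub>?R\<^esub> g \<otimes>\<^bsub>?R\<^esub> h = f \<otimes>\<^bsub>?R\<^esub> (g \<otimes>\<^bsub>?R\<^esub> h)" for f g h
    by (rule mult_assoc_semigroup_ring[OF S])
  show "f \<otimes>\<^bsub>?R\<^esub> g = g \<otimes>\<^bsub>?R\<^esub> f" for f g
    by (rule mult_commute_semigroup_ring)
  show "\<one>\<^bsub>?R\<^esub> \<otimes>\<^bsub>?R\<^esub> f = f" if "f \<in> carrier ?R" for f
    by (rule one_mult_semigroup_ring[OF S that])
qed

lemma umonom_eq_iff [simp]: "(umonom a :: rat \<Rightarrow> 'k::field) = umonom b \<longleftrightarrow> a = b"
  by (auto simp: umonom_def fun_eq_iff split: if_splits)

lemma umonom_carrier: "a \<in> S \<Longrightarrow> umonom a \<in> carrier (semigroup_ring S)"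
  by (auto simp: umonom_def semigroup_ring_def)

lemma one_semigroup_ring: "\<one>\<^bsub>semigroup_ring S\<^esub> = umonom 0"
  by (simp add: umonom_def semigroup_ring_def)

lemma umonom_mult:
  assumes "numerical_semigroup S" "a \<in> S" "b \<in> S"
  shows "umonom a \<otimes>\<^bsub>semigroup_ring S\<^esub> umonom b = (umonom (a + b) :: rat \<Rightarrow> 'k::field)"
proof
  fix x
  show "(umonom a \<otimes>\<^bsub>semigroup_ring S\<^esub> umonom b) x = (umonom (a + b) :: rat \<Rightarrow> 'k) x"
  proof (cases "x - a \<in> S")
    case True
    then have "(umonom a \<otimes>\<^bsub>semigroup_ring S\<^esub> umonom b) x = umonom a a * (umonom b (x - a) :: 'k)"
      by (intro mult_eq_single[OF assms(1,2)]) (simp_all add: umonom_def)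
    then show ?thesis
      by (simp add: umonom_def diff_eq_eq add.commute)
  next
    case False
    then have "x \<noteq> a + b"
      using assms(3) by auto
    moreover have "(\<Sum>c | c \<in> S \<and> x - c \<in> S. umonom a c * umonom b (x - c)) = (0 :: 'k)"
      by (rule sum.neutral) (use False in \<open>auto simp: umonom_def\<close>)
    ultimately show ?thesis
      by (simp add: semigroup_ring_def umonom_def)
  qed
qed

lemma monomial_product_eq:
  fixes s :: "'n::finite \<Rightarrow> rat"
  assumes S: "numerical_semigroup S" and s: "\<And>i. s i \<in> S"
  shows "(\<Sum>i\<in>UNIV. of_nat (l i) * s i) \<in> S"
    and "monomial_product S s l = (umonom (\<Sum>i\<in>UNIV. of_nat (l i) * s i) :: rat \<Rightarrow> 'k::field)"
proof -
  let ?R = "semigroup_ring S :: (rat \<Rightarrow> 'k) ring"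
  interpret comm_monoid ?R by (rule comm_monoid_semigroup_ring[OF S])
  have mult_mem: "of_nat n * a \<in> S" if "a \<in> S" for n a
    by (induction n)
       (simp_all add: that distrib_right numerical_semigroup_zero[OF S] numerical_semigroup_add[OF S])
  have pow: "umonom a [^]\<^bsub>?R\<^esub> n = umonom (of_nat n * a)" if "a \<in> S" for a and n :: nat
    by (induction n)
       (simp_all add: that one_semigroup_ring umonom_mult[OF S] mult_mem distrib_right add.commute)
  \<comment> \<open>Membership is carried through the induction because \<open>umonom_mult\<close>
    requires it of both exponents.\<close>
  have "(\<Sum>i\<in>A. of_nat (l i) * s i) \<in> S \<and>
      (\<Otimes>\<^bsub>?R\<^esub>i\<in>A. umonom (of_nat (l i) * s i)) = umonom (\<Sum>i\<in>A. of_nat (l i) * s i)" for A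
    using finite[of A]
  proof (induction rule: finite_induct)
    case empty
    then show ?case
      by (simp add: one_semigroup_ring numerical_semigroup_zero[OF S])
  next
    case (insert i A)
    have "(\<lambda>i. umonom (of_nat (l i) * s i)) \<in> B \<rightarrow> carrier ?R" for B
      by (simp add: umonom_carrier mult_mem s)
    with insert show ?case
      using finprod_insert[of A i "\<lambda>i. umonom (of_nat (l i) * s i)"]
      by (simp add: Pi_iff s umonom_carrier umonom_mult[OF S] mult_mem numerical_semigroup_add[OF S])
  qed
  from this[of UNIV] show "(\<Sum>i\<in>UNIV. of_nat (l i) * s i) \<in> S"
    and "monomial_product S s l = (umonom (\<Sum>i\<in>UNIV. of_nat (l i) * s i) :: rat \<Rightarrow> 'k)"
    by (auto simp: monomial_product_def pow s)
qed

section \<open>Rectangular decompositions\<close>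

text \<open>The exponent vectors \<open>l\<close> with \<open>l i < \<beta> i\<close> stand for the Apery monomials, and \<open>b i j\<close> for \<open>\<beta>\<^sub>i\<^sub>j\<close>.\<close>

locale rectangular_decomposition =
  fixes S :: "rat set" and s t :: "'n::finite \<Rightarrow> rat" and \<beta> :: "'n \<Rightarrow> nat" and b :: "'n \<Rightarrow> 'n \<Rightarrow> nat"
    and wt :: "('n \<Rightarrow> nat) \<Rightarrow> rat"
  defines "wt \<equiv> \<lambda>l. \<Sum>i\<in>UNIV. of_nat (l i) * s i"
  assumes zero_mem: "0 \<in> S" and add_mem: "x \<in> S \<Longrightarrow> y \<in> S \<Longrightarrow> x + y \<in> S"
    and nonneg: "x \<in> S \<Longrightarrow> 0 \<le> x"
    and unique: "x \<in> S \<Longrightarrow> y \<in> S \<Longrightarrow> (\<And>i. l i < \<beta> i) \<Longrightarrow> (\<And>i. l' i < \<beta> i) \<Longrightarrow>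
      x + wt l = y + wt l' \<Longrightarrow> x = y \<and> l = l'"
    and decompose: "\<exists>x\<in>S. \<exists>l'. (\<forall>i. l' i < \<beta> i) \<and> wt l = x + wt l'"
    and t_mem: "t i \<in> S" and b_less: "b i j < \<beta> j"
    and factorization: "of_nat (\<beta> i) * s i = t i + wt (b i)"
begin

lemma wt_add: "wt (\<lambda>i. l i + l' i) = wt l + wt l'"
  by (simp add: wt_def sum.distrib distrib_right)

lemma wt_diff: "(\<And>i. l' i \<le> l i) \<Longrightarrow> wt (\<lambda>i. l i - l' i) = wt l - wt l'"
  by (simp add: wt_def of_nat_diff sum_subtractf left_diff_distrib)

lemma wt_unit: "wt (\<lambda>i. if i = j then c else 0) = of_nat c * s j"
proof -
  have "wt (\<lambda>i. if i = j then c else 0) = (\<Sum>i\<in>UNIV. if i = j then of_nat c * s i else 0)"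
    unfolding wt_def by (rule sum.cong) auto
  then show ?thesis by simp
qed

lemma \<beta>_pos: "0 < \<beta> i"
  using b_less[of i i] by simp

text \<open>If \<open>b i i\<close> were positive, cancelling \<open>b i i\<close> copies of
  \<open>s i\<close> in the factorization would leave vectors of the rectangle on both sides. They
  agree by uniqueness, and the entries at \<open>i\<close> give
  \<open>\<beta> i \<le> b i i\<close>.\<close>

lemma b_diag: "b i i = 0"
proof -
  let ?l = "\<lambda>j. if j = i then \<beta> i - b i i else 0" and ?l' = "\<lambda>j. if j = i then 0 else b i j"
  have "wt (b i) = wt (\<lambda>j. ?l' j + (if j = i then b i i else 0))"
    by (rule arg_cong[where f = wt]) auto
  also have "\<dots> = wt ?l' + of_nat (b i i) * s i"
    by (simp only: wt_add wt_unit)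
  finally have "0 + wt ?l = t i + wt ?l'"
    using factorization[of i] b_less[of i i]
    by (simp add: wt_unit of_nat_diff less_imp_le left_diff_distrib)
  note eq = this
  show ?thesis
  proof (rule ccontr)
    assume "b i i \<noteq> 0"
    then have "?l j < \<beta> j" "?l' j < \<beta> j" for j
      using \<beta>_pos b_less by simp_all
    have "0 = t i \<and> ?l = ?l'"
      by (rule unique[OF zero_mem t_mem _ _ eq]) fact+
    then have "?l i = ?l' i"
      by (rule fun_cong[OF conjunct2])
    then show False
      using b_less[of i i] by simp
  qed
qed

text \<open>
  Add the factorizations of the indices in \<open>I\<close> and collect the terms of either sign on the two
  sides: both sides then lie in the rectangle, so they vanish.
\<close>

lemma column_sums:
  assumes closed: "\<And>i j. i \<in> I \<Longrightarrow> j \<notin> I \<Longrightarrow> b i j = 0"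
    and hit: "\<And>j. j \<in> I \<Longrightarrow> \<exists>i\<in>I. 0 < b i j"
    and small: "card I \<le> 3" and j: "j \<in> I"
  shows "(\<Sum>i\<in>I. b i j) = \<beta> j"
proof -
  define c where "c j = (\<Sum>i\<in>I. b i j)" for j
  \<comment> \<open>Natural subtraction truncates, so \<open>p\<close> and \<open>q\<close> are the
    positive and negative parts of \<open>\<beta> - c\<close> on \<open>I\<close>; at each index at
    most one of them is non-zero.\<close>
  define p q where "p j = (if j \<in> I then \<beta> j - c j else 0)" and "q j = (if j \<in> I then c j - \<beta> j else 0)" for j
  have c_pos: "0 < c j" if "j \<in> I" for j
    using hit[OF that] by (auto simp: c_def intro!: sum_pos2)
  have c_less: "c j < 2 * \<beta> j" if "j \<in> I" for j
  proof -
    \<comment> \<open>The diagonal entry vanishes, so at most two summands remain, each at most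
      \<open>\<beta> j - 1\<close>.\<close>
    have "c j = (\<Sum>i\<in>I - {j}. b i j)"
      using that by (simp add: c_def sum.remove[of I j] b_diag)
    also have "\<dots> \<le> (\<Sum>i\<in>I - {j}. \<beta> j - 1)"
    proof (rule sum_mono)
      show "b i j \<le> \<beta> j - 1" for i
        using b_less[of i j] by simp
    qed
    also have "\<dots> \<le> 2 * (\<beta> j - 1)"
      using that small by (intro order.trans[OF _ mult_le_mono1[of "card (I - {j})" 2]]) simp_all
    also have "\<dots> < 2 * \<beta> j"
      using \<beta>_pos[of j] by simp
    finally show ?thesis .
  qed
  have c_out: "c j = 0" if "j \<notin> I" for j
    using closed that by (simp add: c_def)
  \<comment> \<open>Positivity of \<open>c j\<close> keeps \<open>p\<close> in the rectangle, and
    \<open>c j < 2 * \<beta> j\<close> keeps \<open>q\<close> in it.\<close>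
  have box: "\<And>j. p j < \<beta> j" "\<And>j. q j < \<beta> j"
  proof -
    show "p j < \<beta> j" for j
      using c_pos[of j] \<beta>_pos[of j] by (simp add: p_def)
    show "q j < \<beta> j" for j
      using c_less[of j] \<beta>_pos[of j] by (simp add: q_def) linarith
  qed
  have sum_t: "(\<Sum>i\<in>J. t i) \<in> S" for J
    using finite[of J] by (induction rule: finite_induct) (auto intro: zero_mem add_mem t_mem)
  have wt_sum: "wt (\<lambda>j. \<Sum>i\<in>J. b i j) = (\<Sum>i\<in>J. wt (b i))" for J
    using finite[of J]
    by (induction rule: finite_induct) (simp_all add: wt_add, simp add: wt_def)
  have wt_\<beta>: "wt (\<lambda>j. if j \<in> I then \<beta> j else 0) = (\<Sum>i\<in>I. of_nat (\<beta> i) * s i)"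
    unfolding wt_def by (simp add: if_distrib if_distribR sum.If_cases cong: if_cong)
  have "wt p + wt c = wt q + wt (\<lambda>j. if j \<in> I then \<beta> j else 0)"
    unfolding wt_add[symmetric]
    by (intro arg_cong[where f = wt] ext) (simp add: p_def q_def c_out, arith)
  also have "\<dots> = wt q + (\<Sum>i\<in>I. t i) + wt c"
    by (simp add: wt_\<beta> factorization sum.distrib wt_sum[of I, folded c_def])
  finally have "0 + wt p = (\<Sum>i\<in>I. t i) + wt q"
    by simp
  then have "0 = (\<Sum>i\<in>I. t i) \<and> p = q"
    by (rule unique[OF zero_mem sum_t box])
  then have "p j = q j"
    by simp
  \<comment> \<open>As one of \<open>p j\<close> and \<open>q j\<close> is 0, equality makes both 0,
    that is, \<open>c j = \<beta> j\<close>.\<close>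
  then show ?thesis
    using j by (simp add: p_def q_def c_def)
qed

text \<open>Let \<open>x = y + wt a\<close> with \<open>a\<close> in the rectangle. If
  \<open>a j > 0\<close>, subtract \<open>s j\<close> from this and from the representation with
  \<open>l j = \<beta> j\<close>. Both vectors now lie in the rectangle, so uniqueness gives
  \<open>a j = \<beta> j\<close>, which is too large. Hence \<open>a = 0\<close>.\<close>

lemma mem_if_all_predecessors:
  assumes "\<And>j. \<exists>l. wt l = x \<and> l j = \<beta> j \<and> (\<forall>i. i \<noteq> j \<longrightarrow> l i < \<beta> i)"
  shows "x \<in> S"
proof -
  obtain l where "wt l = x"
    using assms by blast
  with decompose[of l] obtain y a where y: "y \<in> S" and a: "\<And>i. a i < \<beta> i" and x: "x = y + wt a"
    by auto
  have "a j = 0" for j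
  proof (rule ccontr)
    assume aj: "a j \<noteq> 0"
    obtain l where l: "wt l = x" "l j = \<beta> j" "\<forall>i. i \<noteq> j \<longrightarrow> l i < \<beta> i"
      using assms by blast
    let ?e = "\<lambda>i. if i = j then 1 else 0 :: nat"
    have "0 + wt (\<lambda>i. l i - ?e i) = y + wt (\<lambda>i. a i - ?e i)"
      using l aj \<beta>_pos[of j] by (subst (1 2) wt_diff) (auto simp: x)
    then have "0 = y \<and> (\<lambda>i. l i - ?e i) = (\<lambda>i. a i - ?e i)"
    proof (rule unique[OF zero_mem y, rotated 2])
      show "l i - ?e i < \<beta> i" for i
        using l \<beta>_pos[of i] by (cases "i = j") simp_all
      show "a i - ?e i < \<beta> i" for i
        using a[of i] by simp
    qed
    then have "l j - ?e j = a j - ?e j"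
      by (rule fun_cong[OF conjunct2])
    then show False
      using l aj a[of j] by simp
  qed
  then show ?thesis
    using x y by (simp add: wt_def)
qed

end

section \<open>The case of three minimal monomials\<close>

lemma sum_UNIV_3:
  fixes f :: "3 \<Rightarrow> 'a::comm_monoid_add"
  assumes "i \<noteq> j" "i \<noteq> k" "j \<noteq> k"
  shows "(\<Sum>x\<in>UNIV. f x) = f i + f j + f k"
proof -
  have "UNIV = {i, j, k}"
    using assms exhaust_3[of i] exhaust_3[of j] exhaust_3[of k] by (auto simp: UNIV_3)
  moreover have "(\<Sum>x\<in>{i, j, k}. f x) = f i + f j + f k"
    using assms by (simp add: ac_simps)
  ultimately show ?thesis
    by simp
qed

lemma ex_distinct_3:
  fixes c :: 3
  obtains a d where "a \<noteq> c" "d \<noteq> c" "a \<noteq> d" "UNIV = {a, d, c}"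
proof -
  consider "c = 1" | "c = 2" | "c = 3"
    using exhaust_3[of c] by blast
  then show ?thesis
  proof cases
    case 1
    then show ?thesis using UNIV_3 by (intro that[of 2 3]) auto
  next
    case 2
    then show ?thesis using UNIV_3 by (intro that[of 1 3]) auto
  next
    case 3
    then show ?thesis using UNIV_3 by (intro that[of 1 2]) auto
  qed
qed

locale rectangular_decomposition_3 = rectangular_decomposition S s t \<beta> b wt
  for S s t and \<beta> :: "3 \<Rightarrow> nat" and b wt
begin

lemma wt_3:
  assumes "i \<noteq> j" "i \<noteq> k" "j \<noteq> k"
  shows "wt l = of_nat (l i) * s i + of_nat (l j) * s j + of_nat (l k) * s k"
  unfolding wt_def by (rule sum_UNIV_3[OF assms])

text \<open>In the sum of the three factorizations the column sums cancel every multiple of the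
  \<open>s i\<close>. What remains is that the non-negative \<open>t i\<close> add up to 0.\<close>

lemma t_eq_0_if_column_sums:
  assumes col: "\<And>i j k. i \<noteq> j \<Longrightarrow> i \<noteq> k \<Longrightarrow> j \<noteq> k \<Longrightarrow> \<beta> j = b i j + b k j"
  shows "t i = 0"
proof -
  obtain j k where d: "j \<noteq> i" "k \<noteq> i" "j \<noteq> k"
    by (rule ex_distinct_3[of i])
  have eqs: "of_nat (\<beta> x) * s x = t x + (of_nat (b x i) * s i + of_nat (b x j) * s j + of_nat (b x k) * s k)" for x
    using factorization[of x] wt_3[of i j k "b x"] d by simp
  have "t i + t j + t k = 0"
    using eqs[of i] eqs[of j] eqs[of k] col[of i j k] col[of j i k] col[of i k j] d
    by (simp add: b_diag algebra_simps)
  then show ?thesis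
    using nonneg[OF t_mem[of i]] nonneg[OF t_mem[of j]] nonneg[OF t_mem[of k]] by linarith
qed

text \<open>
  The exponent vectors \<open>(\<beta>\<^sub>i, b\<^sub>k\<^sub>j, 0)\<close>, \<open>(0, \<beta>\<^sub>j, b\<^sub>i\<^sub>k)\<close> and \<open>(b\<^sub>j\<^sub>i, 0, \<beta>\<^sub>k)\<close> in the coordinates \<open>i, j, k\<close>
  have the same weight, and each is one step away from the rectangle.
\<close>

lemma corner_mem:
  assumes col: "\<And>i j k. i \<noteq> j \<Longrightarrow> i \<noteq> k \<Longrightarrow> j \<noteq> k \<Longrightarrow> \<beta> j = b i j + b k j"
    and d: "i \<noteq> j" "i \<noteq> k" "j \<noteq> k"
  shows "of_nat (\<beta> i) * s i + of_nat (b k j) * s j \<in> S" (is "?x \<in> S")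
proof (rule mem_if_all_predecessors)
  fix c
  have eqs: "of_nat (\<beta> x) * s x = of_nat (b x i) * s i + of_nat (b x j) * s j + of_nat (b x k) * s k" for x
    using factorization[of x] wt_3[of i j k "b x"] d t_eq_0_if_column_sums[OF col] by simp
  let ?v = "\<lambda>p q r x. if x = i then p else if x = j then q else r"
  have v: "wt (?v p q r) = of_nat p * s i + of_nat q * s j + of_nat r * s k" for p q r
    using d by (simp add: wt_3[of i j k])
  \<comment> \<open>Replace \<open>\<beta> i * s i\<close> by its factorization; column
    \<open>j\<close> then adds up to \<open>\<beta> j\<close>.\<close>
  have x2: "?x = of_nat (\<beta> j) * s j + of_nat (b i k) * s k"
    using eqs[of i] col[of i j k] d by (simp add: b_diag algebra_simps)
  \<comment> \<open>Now replace \<open>\<beta> j * s j\<close>; column \<open>k\<close> adds up to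
    \<open>\<beta> k\<close>.\<close>
  have x3: "?x = of_nat (b j i) * s i + of_nat (\<beta> k) * s k"
    using x2 eqs[of j] col[of i k j] d by (simp add: b_diag algebra_simps)
  have only: "x \<noteq> i \<Longrightarrow> x \<noteq> j \<Longrightarrow> x = k" for x
    using d exhaust_3[of x] exhaust_3[of i] exhaust_3[of j] exhaust_3[of k] by auto
  then consider "c = i" | "c = j" | "c = k"
    by blast
  then show "\<exists>l. wt l = ?x \<and> l c = \<beta> c \<and> (\<forall>i. i \<noteq> c \<longrightarrow> l i < \<beta> i)"
  proof cases
    case 1
    then show ?thesis
      using d by (intro exI[of _ "?v (\<beta> i) (b k j) 0"]) (simp add: v b_less \<beta>_pos)
  next
    case 2
    have "\<forall>x. x \<noteq> c \<longrightarrow> ?v 0 (\<beta> j) (b i k) x < \<beta> x"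
    proof (intro allI impI)
      fix x assume "x \<noteq> c"
      then consider "x = i" | "x = k"
        using 2 only by blast
      then show "?v 0 (\<beta> j) (b i k) x < \<beta> x"
        by cases (use d b_less \<beta>_pos in simp_all)
    qed
    then show ?thesis
      using 2 d x2 by (intro exI[of _ "?v 0 (\<beta> j) (b i k)"]) (simp add: v)
  next
    case 3
    have "\<forall>x. x \<noteq> c \<longrightarrow> ?v (b j i) 0 (\<beta> k) x < \<beta> x"
    proof (intro allI impI)
      fix x assume "x \<noteq> c"
      then consider "x = i" | "x = j"
        using 3 only by blast
      then show "?v (b j i) 0 (\<beta> k) x < \<beta> x"
        by cases (use d b_less \<beta>_pos in simp_all)
    qed
    then show ?thesis
      using 3 d x3 by (intro exI[of _ "?v (b j i) 0 (\<beta> k)"]) (simp add: v)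
  qed
qed

lemma ex_zero_column: "\<exists>c. \<forall>i. i \<noteq> c \<longrightarrow> b i c = 0"
proof (rule ccontr)
  assume "\<not> ?thesis"
  then have hit: "\<exists>i. 0 < b i c" for c
    by (metis gr0I)
  have col: "\<beta> j = b i j + b k j" if "i \<noteq> j" "i \<noteq> k" "j \<noteq> k" for i j k
    using column_sums[of UNIV j] hit that b_diag[of j] by (simp add: sum_UNIV_3[of i j k])
  obtain j k :: 3 where d: "j \<noteq> 1" "k \<noteq> 1" "j \<noteq> k"
    by (rule ex_distinct_3[of 1])
  \<comment> \<open>\<open>?y\<close> is the corner with the roles of \<open>j\<close> and
    \<open>k\<close> exchanged.\<close>
  let ?x = "of_nat (\<beta> 1) * s 1 + of_nat (b k j) * s j" and ?y = "of_nat (\<beta> 1) * s 1 + of_nat (b j k) * s k"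
  let ?l = "\<lambda>x. if x = k then b j k else 0" and ?l' = "\<lambda>x. if x = j then b k j else 0"
  have mem: "?x \<in> S" "?y \<in> S"
    by (rule corner_mem[OF col]; use d in simp)+
  have "?x + wt ?l = ?y + wt ?l'"
    by (simp add: wt_unit)
  then have "?x = ?y \<and> ?l = ?l'"
    by (rule unique[OF mem, rotated 2]) (simp_all add: b_less \<beta>_pos)
  then have "?l j = ?l' j"
    by (rule fun_cong[OF conjunct2])
  \<comment> \<open>The entries at \<open>j\<close> give \<open>b k j = 0\<close>, so
    \<open>b 1 j\<close> alone would make up the column sum \<open>\<beta> j\<close>.\<close>
  then show False
    using d col[of 1 j k] b_less[of 1 j] by simp
qed

text \<open>Take \<open>c\<close> with zero column. If \<open>b a d\<close> and \<open>b d a\<close>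
  were both positive, then \<open>{a, d}\<close> would satisfy the hypotheses of
  \<open>column_sums\<close>, and column \<open>a\<close> would give
  \<open>b d a = \<beta> a\<close>.\<close>

lemma ex_acyclic_order:
  obtains a d c where "a \<noteq> c" "d \<noteq> c" "a \<noteq> d" "b a c = 0" "b d c = 0" "b d a = 0"
proof -
  obtain c where c: "\<And>i. i \<noteq> c \<Longrightarrow> b i c = 0"
    using ex_zero_column by blast
  obtain a d where d: "a \<noteq> c" "d \<noteq> c" "a \<noteq> d" "UNIV = {a, d, c}"
    using ex_distinct_3[of c] by blast
  have "b a d = 0 \<or> b d a = 0"
  proof (rule ccontr)
    assume "\<not> ?thesis"
    then have "\<exists>i\<in>{a, d}. 0 < b i j" if "j \<in> {a, d}" for j
      using that by auto
    moreover have "b i j = 0" if "i \<in> {a, d}" "j \<notin> {a, d}" for i j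
    proof -
      have "j = c" "i \<noteq> c"
        using that d UNIV_I[of j] by auto
      then show ?thesis
        using c by simp
    qed
    ultimately have "(\<Sum>i\<in>{a, d}. b i a) = \<beta> a"
      by (intro column_sums) (simp_all add: card_insert_if)
    then show False
      using d b_less[of d a] by (simp add: b_diag)
  qed
  then show ?thesis
  proof
    assume "b a d = 0"
    \<comment> \<open>Here \<open>a\<close> and \<open>d\<close> exchange their roles.\<close>
    with that[of d c a] c d show ?thesis by simp
  next
    assume "b d a = 0"
    with that[of a c d] c d show ?thesis by simp
  qed
qed

end

section \<open>Flatness and unique decompositions\<close>

text \<open>Flatness is tested on modules over the type \<open>(nat \<Rightarrow> 'a) set\<close>. A
  series is coded there as the singleton of a constant sequence, so that ideals become test
  modules.\<close>

definition test_elem :: "'a \<Rightarrow> (nat \<Rightarrow> 'a) set" where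
  "test_elem f = {\<lambda>_. f}"

definition test_val :: "(nat \<Rightarrow> 'a) set \<Rightarrow> 'a" where
  "test_val X = the_elem X 0"

text \<open>
  The module lives in the type of the test modules of flatness; the fields \<open>mult\<close> and \<open>one\<close> play
  no role.
\<close>

definition supported_module ::
  "rat set \<Rightarrow> rat set \<Rightarrow> (rat \<Rightarrow> 'k::field, (nat \<Rightarrow> rat \<Rightarrow> 'k) set) module" where
  "supported_module S J =
     \<lparr>carrier = test_elem ` {f. \<forall>x. x \<notin> J \<longrightarrow> f x = 0},
      monoid.mult = (\<lambda>X Y. X),
      one = {},
      zero = test_elem (\<lambda>x. 0),
      add = (\<lambda>X Y. test_elem (\<lambda>x. test_val X x + test_val Y x)),
      smult = (\<lambda>a X. test_elem (a \<otimes>\<^bsub>semigroup_ring S\<^esub> test_val X))\<rparr>"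

lemma test_val_test_elem [simp]: "test_val (test_elem f) = f"
  by (simp add: test_val_def test_elem_def)

text \<open>Stability of \<open>J\<close> makes these series an ideal: if \<open>x\<close> is
  outside \<open>J\<close>, so is \<open>x - b\<close> for every \<open>b\<close> in
  \<open>S\<close>, and no term of the product contributes at \<open>x\<close>.\<close>

lemma module_supported_module:
  fixes S J :: "rat set"
  assumes S: "numerical_semigroup S" and R: "cring (semigroup_ring S :: (rat \<Rightarrow> 'k::field) ring)"
    and J: "J \<subseteq> S" and stable: "\<And>a x. a \<in> S \<Longrightarrow> x \<in> J \<Longrightarrow> a + x \<in> J"
  shows "Module.module (semigroup_ring S) (supported_module S J :: (rat \<Rightarrow> 'k, (nat \<Rightarrow> rat \<Rightarrow> 'k) set) module)"
proof (rule moduleI[OF R])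
  let ?R = "semigroup_ring S :: (rat \<Rightarrow> 'k) ring"
  let ?M = "supported_module S J :: (rat \<Rightarrow> 'k, (nat \<Rightarrow> rat \<Rightarrow> 'k) set) module"
  interpret R: cring ?R by (rule R)
  have elim: "\<exists>f. X = test_elem f \<and> f \<in> carrier ?R \<and> (\<forall>x. x \<notin> J \<longrightarrow> f x = 0)" if "X \<in> carrier ?M" for X
    using that J by (auto simp: supported_module_def semigroup_ring_def)
  show "abelian_group ?M"
  proof (rule abelian_groupI)
    fix X assume "X \<in> carrier ?M"
    then obtain f where "X = test_elem f" "\<forall>x. x \<notin> J \<longrightarrow> f x = 0"
      using elim by blast
    then show "\<exists>Y\<in>carrier ?M. Y \<oplus>\<^bsub>?M\<^esub> X = \<zero>\<^bsub>?M\<^esub>"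
      by (intro bexI[of _ "test_elem (\<lambda>x. - f x)"]) (simp_all add: supported_module_def)
  qed (auto simp: supported_module_def ac_simps)
  fix a :: "rat \<Rightarrow> 'k" and X assume a: "a \<in> carrier ?R" and X: "X \<in> carrier ?M"
  then obtain f where f: "X = test_elem f" "f \<in> carrier ?R" "\<And>x. x \<notin> J \<Longrightarrow> f x = 0"
    using elim by blast
  have "(a \<otimes>\<^bsub>?R\<^esub> f) x = 0" if "x \<notin> J" for x
  proof -
    have "a b * f (x - b) = 0" if "b \<in> S" for b
      using stable[OF that, of "x - b"] f(3)[of "x - b"] \<open>x \<notin> J\<close> by auto
    then show ?thesis
      by (auto simp: semigroup_ring_def intro!: sum.neutral)
  qed
  then show "a \<odot>\<^bsub>?M\<^esub> X \<in> carrier ?M"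
    by (simp add: supported_module_def f)
next
  let ?R = "semigroup_ring S :: (rat \<Rightarrow> 'k) ring"
  let ?M = "supported_module S J :: (rat \<Rightarrow> 'k, (nat \<Rightarrow> rat \<Rightarrow> 'k) set) module"
  interpret R: cring ?R by (rule R)
  have elim: "\<exists>f. X = test_elem f \<and> f \<in> carrier ?R" if "X \<in> carrier ?M" for X
    using that J by (auto simp: supported_module_def semigroup_ring_def)
  have smult: "a \<odot>\<^bsub>?M\<^esub> test_elem f = test_elem (a \<otimes>\<^bsub>?R\<^esub> f)" for a f
    by (simp add: supported_module_def)
  have plus: "test_elem f \<oplus>\<^bsub>?M\<^esub> test_elem g = test_elem (f \<oplus>\<^bsub>?R\<^esub> g)" for f g
    by (simp add: supported_module_def semigroup_ring_def)
  fix a b :: "rat \<Rightarrow> 'k" and X Y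
  show "(a \<oplus>\<^bsub>?R\<^esub> b) \<odot>\<^bsub>?M\<^esub> X = a \<odot>\<^bsub>?M\<^esub> X \<oplus>\<^bsub>?M\<^esub> b \<odot>\<^bsub>?M\<^esub> X"
    if "a \<in> carrier ?R" "b \<in> carrier ?R" "X \<in> carrier ?M"
    using elim[OF that(3)] that by (auto simp: smult plus R.l_distr)
  show "a \<odot>\<^bsub>?M\<^esub> (X \<oplus>\<^bsub>?M\<^esub> Y) = a \<odot>\<^bsub>?M\<^esub> X \<oplus>\<^bsub>?M\<^esub> a \<odot>\<^bsub>?M\<^esub> Y"
    if "a \<in> carrier ?R" "X \<in> carrier ?M" "Y \<in> carrier ?M"
    using elim[OF that(2)] elim[OF that(3)] that by (auto simp: smult plus R.r_distr)
  show "(a \<otimes>\<^bsub>?R\<^esub> b) \<odot>\<^bsub>?M\<^esub> X = a \<odot>\<^bsub>?M\<^esub> (b \<odot>\<^bsub>?M\<^esub> X)"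
    if "a \<in> carrier ?R" "b \<in> carrier ?R" "X \<in> carrier ?M"
    using elim[OF that(3)] that by (auto simp: smult R.m_assoc)
  show "\<one>\<^bsub>?R\<^esub> \<odot>\<^bsub>?M\<^esub> X = X" if "X \<in> carrier ?M"
    using elim[OF that] by (auto simp: smult)
qed

section \<open>Apery elements and decompositions\<close>

definition apery_set :: "rat set \<Rightarrow> rat set \<Rightarrow> rat set" where
  "apery_set S S' = {a \<in> S'. \<forall>t\<in>S. a - t \<in> S' \<longrightarrow> t = 0}"

lemma apery_monomials_eq:
  assumes S': "numerical_semigroup S'" and sub: "S \<subseteq> S'"
  shows "apery_monomials S S' = (umonom ` apery_set S S' :: (rat \<Rightarrow> 'k::field) set)"
proof -
  have "umonom a \<in> (apery_monomials S S' :: (rat \<Rightarrow> 'k) set) \<longleftrightarrow> (\<forall>t\<in>S. \<forall>b\<in>S'. a = t + b \<longrightarrow> t = 0)"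
    if "a \<in> S'" for a
    using that sub
    by (auto simp: apery_monomials_def monomials_def one_semigroup_ring umonom_mult[OF S'] subset_iff)
  moreover have "(\<forall>t\<in>S. \<forall>b\<in>S'. a = t + b \<longrightarrow> t = 0) \<longleftrightarrow> (\<forall>t\<in>S. a - t \<in> S' \<longrightarrow> t = 0)" for a
    by (metis add_diff_cancel_left' add_diff_inverse diff_add_cancel add.commute)
  ultimately show ?thesis
    by (auto simp: apery_set_def) (auto simp: apery_monomials_def monomials_def apery_set_def)
qed

text \<open>Descent: an element that is not Apery stays in \<open>S'\<close> after subtracting some
  non-zero \<open>u\<close> in \<open>S\<close>, and each subtraction lowers it by at least the gap
  of \<open>S\<close>.\<close>

lemma ex_apery_decomposition:
  assumes S: "numerical_semigroup S" and S': "numerical_semigroup S'" and x: "x \<in> S'"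
  shows "\<exists>t\<in>S. \<exists>a\<in>apery_set S S'. x = t + a"
proof -
  obtain \<delta> where \<delta>: "0 < \<delta>" "\<And>a. a \<in> S \<Longrightarrow> a = 0 \<or> \<delta> \<le> a"
    using numerical_semigroup_gap[OF S] by metis
  have "x < of_nat n * \<delta> \<Longrightarrow> ?thesis" for n
    using x
  proof (induction n arbitrary: x)
    case 0
    then show ?case
      using numerical_semigroup_nonneg[OF S', of x] by simp
  next
    case (Suc n)
    show ?case
    proof (cases "x \<in> apery_set S S'")
      case True
      then show ?thesis
        using numerical_semigroup_zero[OF S] by force
    next
      case False
      then obtain u where u: "u \<in> S" "x - u \<in> S'" "u \<noteq> 0"
        using Suc.prems by (auto simp: apery_set_def)
      then have "x - u < of_nat n * \<delta>"
        using \<delta>(2)[of u] Suc.prems by (auto simp: distrib_right)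
      with Suc.IH u obtain t a where "t \<in> S" "a \<in> apery_set S S'" "x - u = t + a"
        by blast
      then show ?thesis
        using numerical_semigroup_add[OF S u(1), of t]
        by (intro bexI[of _ "u + t"] bexI[of _ a]) (simp_all add: algebra_simps)
    qed
  qed
  moreover obtain n where "x / \<delta> < of_nat n"
    using reals_Archimedean2 by blast
  ultimately show ?thesis
    using \<delta>(1) by (simp add: pos_divide_less_eq)
qed

text \<open>
  If \<open>t - t'\<close> is not in \<open>S\<close>, then \<open>x \<otimes> y \<mapsto> x\<^sub>t y\<^sub>a\<close> is well defined on the tensor product of the ideal
  of series supported in \<open>(t + S) \<union> (t' + S)\<close> with the algebra, and distinguishes \<open>u\<^sup>t \<otimes> u\<^sup>a\<close> from
  \<open>u\<^sup>t' \<otimes> u\<^sup>a'\<close>. These two have the same image \<open>1 \<otimes> u\<^sup>t\<^sup>+\<^sup>a\<close> over the whole ring, against flatness.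
\<close>

lemma flat_decomposition_diff:
  assumes S: "numerical_semigroup S" and S': "numerical_semigroup S'" and sub: "S \<subseteq> S'"
    and flat: "flat_module (semigroup_ring S) (semigroup_algebra S' :: (rat \<Rightarrow> 'k::field, rat \<Rightarrow> 'k) module)"
    and t: "t \<in> S" "t' \<in> S" and a: "a \<in> apery_set S S'" and a': "a' \<in> S'" and eq: "t + a = t' + a'"
  shows "t - t' \<in> S"
proof (rule ccontr)
  assume notin: "t - t' \<notin> S"
  let ?R = "semigroup_ring S :: (rat \<Rightarrow> 'k) ring"
  let ?F = "semigroup_algebra S' :: (rat \<Rightarrow> 'k, rat \<Rightarrow> 'k) module"
  define J where "J = (+) t ` S \<union> (+) t' ` S"
  let ?M = "supported_module S J :: (rat \<Rightarrow> 'k, (nat \<Rightarrow> rat \<Rightarrow> 'k) set) module"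
  let ?N = "supported_module S S :: (rat \<Rightarrow> 'k, (nat \<Rightarrow> rat \<Rightarrow> 'k) set) module"
  let ?u = "umonom :: rat \<Rightarrow> rat \<Rightarrow> 'k" and ?e = "test_elem :: (rat \<Rightarrow> 'k) \<Rightarrow> _"
  have F: "Module.module ?R ?F"
    using flat by (simp add: flat_module_def)
  then interpret F: Module.module ?R ?F .
  \<comment> \<open>The ring axioms come from the module hypothesis contained in
    \<open>flat\<close>.\<close>
  have R: "cring ?R" ..
  have aS': "a \<in> S'"
    using a by (simp add: apery_set_def)
  have J_sub: "J \<subseteq> S"
    using numerical_semigroup_add[OF S] t by (auto simp: J_def)
  have J_stable: "r + x \<in> J" if "r \<in> S" "x \<in> J" for r x
    using that numerical_semigroup_add[OF S] unfolding J_def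
    by (auto simp: image_iff)
  have t_J: "t \<in> J" "t' \<in> J"
    using numerical_semigroup_zero[OF S] by (auto simp: J_def image_iff)
  have M: "Module.module ?R ?M"
    by (rule module_supported_module[OF S R J_sub J_stable])
  have N: "Module.module ?R ?N"
    by (rule module_supported_module[OF S R subset_refl numerical_semigroup_add[OF S]])
  have MN: "carrier ?M \<subseteq> carrier ?N"
    using J_sub by (auto simp: supported_module_def)
  have id_hom: "id \<in> module_homs ?R ?M ?N"
    using MN by (auto simp: module_homs_def supported_module_def)
  have u_M: "?e (?u x) \<in> carrier ?M" if "x \<in> J" for x
    using that by (auto simp: supported_module_def umonom_def)
  have u_N: "?e (?u x) \<in> carrier ?N" if "x \<in> S" for x
    using that by (auto simp: supported_module_def umonom_def)
  have u_F: "?u x \<in> carrier ?F" if "x \<in> S'" for x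
    using umonom_carrier[OF that] by (simp add: semigroup_algebra_def)
  \<comment> \<open>Over the whole ring the scalar \<open>u\<^sup>r\<close> moves across the tensor
    sign, onto the algebra factor.\<close>
  have "frag_of (?e (?u r), ?u b) - frag_of (?e (?u 0), ?u (r + b)) \<in> tensor_null ?R ?N ?F"
    if r: "r \<in> S" "b \<in> S'" for r b
  proof -
    have "frag_of (?u r \<odot>\<^bsub>?N\<^esub> ?e (?u 0), ?u b) - frag_of (?e (?u 0), ?u r \<odot>\<^bsub>?F\<^esub> ?u b) \<in> tensor_relators ?R ?N ?F"
      unfolding tensor_relators_def
      using u_N[OF numerical_semigroup_zero[OF S]] u_F[OF r(2)] umonom_carrier[OF r(1)] by blast
    moreover have "?u r \<odot>\<^bsub>?N\<^esub> ?e (?u 0) = ?e (?u r)"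
      using umonom_mult[OF S r(1) numerical_semigroup_zero[OF S], where 'k = 'k] by (simp add: supported_module_def)
    moreover have "?u r \<odot>\<^bsub>?F\<^esub> ?u b = ?u (r + b)"
      using umonom_mult[OF S' _ r(2), of r, where 'k = 'k] r(1) sub by (auto simp: semigroup_algebra_def)
    ultimately show ?thesis
      using tensor_null_closed(5)[OF N F] by simp
  qed
  from this[OF t(1) aS'] this[OF t(2) a']
  have "frag_of (?e (?u t), ?u a) - frag_of (?e (?u t'), ?u a') \<in> tensor_null ?R ?N ?F"
    using tensor_null_closed(4)[OF N F] eq by fastforce
  moreover have "(\<lambda>(x, y). frag_of (id x, y)) = (\<lambda>p. frag_of p :: _ \<Rightarrow>\<^sub>0 int)"
    by auto
  ultimately have "frag_of (?e (?u t), ?u a) - frag_of (?e (?u t'), ?u a') \<in> tensor_null ?R ?M ?F"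
    using u_M t_J u_F aS' a'
    by (intro flat_module_tensor_null[OF flat M N id_hom])
       (auto simp: frag_extend_diff keys_frag_of dest!: keys_diff[THEN subsetD])
  then have "(\<lambda>(X, y). test_val X t * y a) (?e (?u t), ?u a) = (\<lambda>(X, y). test_val X t * y a) (?e (?u t'), ?u a')"
  proof (rule balanced_eq_if_tensor_null[OF M F, rotated -1])
    fix r X y assume r: "r \<in> carrier ?R" and X: "X \<in> carrier ?M" and y: "y \<in> carrier ?F"
    then obtain f where f: "X = ?e f" "\<And>x. x \<notin> J \<Longrightarrow> f x = 0"
      by (auto simp: supported_module_def)
    have r0: "r x = 0" if "x \<notin> S" for x
      using r that by (simp add: semigroup_ring_def)
    \<comment> \<open>Only the constant term of \<open>r\<close> contributes: if
      \<open>t - b\<close> were in \<open>J\<close> with \<open>b \<noteq> 0\<close>, then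
      \<open>b + c = 0\<close> or \<open>t - t' = b + c\<close> for some \<open>c\<close> in
      \<open>S\<close>, and both are impossible.\<close>
    have "(r \<otimes>\<^bsub>?R\<^esub> f) t = r 0 * f (t - 0)"
    proof (rule mult_eq_single[OF S numerical_semigroup_zero[OF S]])
      show "t - 0 \<in> S" using t by simp
      fix b assume b: "b \<in> S" "b \<noteq> 0"
      have "t - b \<notin> J"
      proof
        assume "t - b \<in> J"
        then consider c where "c \<in> S" "t - b = t + c" | c where "c \<in> S" "t - b = t' + c"
          by (auto simp: J_def)
        then show False
        proof cases
          case 1
          then show ?thesis
            using b numerical_semigroup_nonneg[OF S, of b] numerical_semigroup_nonneg[OF S, of c] by simp
        next
          case 2
          then have "t - t' = b + c" by simp
          then show ?thesis
            using notin numerical_semigroup_add[OF S b(1) 2(1)] by simp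
        qed
      qed
      then show "r b * f (t - b) = 0"
        using f by simp
    qed
    \<comment> \<open>On the algebra side the Apery property of \<open>a\<close> leaves the constant
      term only, so both sides equal \<open>r 0 * f t * y a\<close>.\<close>
    moreover have "(r \<otimes>\<^bsub>semigroup_ring S'\<^esub> y) a = r 0 * y (a - 0)"
    proof (rule mult_eq_single[OF S' numerical_semigroup_zero[OF S']])
      show "a - 0 \<in> S'" using aS' by simp
      fix b assume "b \<in> S'" "a - b \<in> S'" "b \<noteq> 0"
      then have "b \<notin> S"
        using a by (auto simp: apery_set_def)
      then show "r b * y (a - b) = 0"
        using r0 by simp
    qed
    ultimately show "(\<lambda>(X, y). test_val X t * y a) (r \<odot>\<^bsub>?M\<^esub> X, y) = (\<lambda>(X, y). test_val X t * y a) (X, r \<odot>\<^bsub>?F\<^esub> y)"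
      by (simp add: f supported_module_def semigroup_algebra_def)
  qed (auto simp: supported_module_def semigroup_algebra_def semigroup_ring_def algebra_simps)
  \<comment> \<open>The functional takes the value 1 on the first tensor and 0 on the
    second.\<close>
  moreover have "t \<noteq> t'"
    using notin numerical_semigroup_zero[OF S] by auto
  ultimately show False
    by (simp add: umonom_def)
qed

text \<open>The difference \<open>t - t'\<close> lies in \<open>S\<close>, and subtracting it from
  \<open>a'\<close> gives \<open>a\<close> in \<open>S'\<close>; as \<open>a'\<close> is Apery, it
  is 0.\<close>

lemma flat_decomposition_unique:
  assumes "numerical_semigroup S" "numerical_semigroup S'" "S \<subseteq> S'"
    and "flat_module (semigroup_ring S) (semigroup_algebra S' :: (rat \<Rightarrow> 'k::field, rat \<Rightarrow> 'k) module)"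
    and "t \<in> S" "t' \<in> S" and a: "a \<in> apery_set S S'" and a': "a' \<in> apery_set S S'" and eq: "t + a = t' + a'"
  shows "t = t'"
proof -
  have "a \<in> S'" "a' \<in> S'"
    using a a' by (auto simp: apery_set_def)
  then have "t - t' \<in> S"
    using flat_decomposition_diff[OF assms(1-6) a _ eq] by blast
  moreover have "a' - (t - t') = a"
    using eq by simp
  ultimately show ?thesis
    using a' \<open>a \<in> S'\<close> by (auto simp: apery_set_def)
qed

section \<open>Triangular form\<close>

text \<open>Passage from monomials to exponents. Descent gives existence of decompositions; flatness
  determines the part in \<open>S\<close>, and the rectangle then the exponent vector. This
  uniqueness also evaluates the \<open>THE\<close> in \<open>log_exponents\<close>.\<close>

lemma rectangular_decomposition_log_exponents:
  fixes s :: "'n::finite \<Rightarrow> rat" and \<beta> :: "'n \<Rightarrow> nat"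
  assumes S: "numerical_semigroup S" and S': "numerical_semigroup S'" and sub: "S \<subseteq> S'"
    and s: "\<And>i. s i \<in> S'"
    and flat: "flat_module (semigroup_ring S) (semigroup_algebra S' :: (rat \<Rightarrow> 'k::field, rat \<Rightarrow> 'k) module)"
    and rect: "apery_rectangle TYPE('k) S S' s \<beta>"
  shows "\<exists>t. rectangular_decomposition S s t \<beta> (log_exponents TYPE('k) S S' s \<beta>)"
proof -
  let ?box = "\<lambda>l. \<forall>i. l i < \<beta> i"
  define wt where "wt l = (\<Sum>i\<in>UNIV. of_nat (l i) * s i)" for l
  have prod: "monomial_product S' s l = (umonom (wt l) :: rat \<Rightarrow> 'k)" and wt_mem: "wt l \<in> S'" for l
    using monomial_product_eq[OF S' s] by (simp_all add: wt_def)
  have apery: "\<exists>!l. ?box l \<and> a = wt l" if "a \<in> apery_set S S'" for a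
    using rect that by (simp add: apery_rectangle_def apery_monomials_eq[OF S' sub] prod)
  have wt_apery: "wt l \<in> apery_set S S'" if "?box l" for l
    using rect that by (auto simp: apery_rectangle_def apery_monomials_eq[OF S' sub] prod image_iff)
  have unique: "x = y \<and> l = l'"
    if "x \<in> S" "y \<in> S" "?box l" "?box l'" "x + wt l = y + wt l'" for x y l l'
  proof -
    have "x = y"
      using flat_decomposition_unique[OF S S' sub flat] that wt_apery by blast
    then show ?thesis
      using apery[OF wt_apery[OF that(3)]] that by auto
  qed
  have decompose: "\<exists>x\<in>S. \<exists>l'. ?box l' \<and> wt l = x + wt l'" for l
    using ex_apery_decomposition[OF S S' wt_mem[of l]] apery by metis
  have "\<exists>x\<in>S. \<exists>l'. ?box l' \<and> of_nat (\<beta> i) * s i = x + wt l'" for i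
  proof -
    \<comment> \<open>The vector with single entry \<open>\<beta> i\<close> lies just outside the
      rectangle; decomposing its weight is the factorization sought.\<close>
    have "wt (\<lambda>j. if j = i then \<beta> i else 0) = (\<Sum>j\<in>UNIV. if j = i then of_nat (\<beta> i) * s i else 0)"
      unfolding wt_def by (rule sum.cong) auto
    then show ?thesis
      using decompose[of "\<lambda>j. if j = i then \<beta> i else 0"] by simp
  qed
  then obtain t b where t: "\<And>i. t i \<in> S" and b: "\<And>i j. b i j < \<beta> j"
    and fact: "\<And>i. of_nat (\<beta> i) * s i = t i + wt (b i)"
    by metis
  have mult: "umonom x \<otimes>\<^bsub>semigroup_ring S'\<^esub> umonom (wt l) = (umonom (x + wt l) :: rat \<Rightarrow> 'k)"
    if "x \<in> S" for x l
    using umonom_mult[OF S' _ wt_mem] that sub by blast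
  have "log_exponents TYPE('k) S S' s \<beta> i = b i" for i
    unfolding log_exponents_def
  proof (rule the_equality)
    show "?box (b i) \<and> (\<exists>x\<in>S. (umonom (s i * of_nat (\<beta> i)) :: rat \<Rightarrow> 'k)
        = umonom x \<otimes>\<^bsub>semigroup_ring S'\<^esub> monomial_product S' s (b i))"
      using t[of i] b fact[of i] by (auto simp: prod mult mult.commute intro!: bexI[of _ "t i"])
  next
    fix l assume "?box l \<and> (\<exists>x\<in>S. (umonom (s i * of_nat (\<beta> i)) :: rat \<Rightarrow> 'k)
        = umonom x \<otimes>\<^bsub>semigroup_ring S'\<^esub> monomial_product S' s l)"
    then obtain x where "?box l" "x \<in> S" "s i * of_nat (\<beta> i) = x + wt l"
      by (auto simp: prod mult)
    then show "l = b i"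
      using unique[of x "t i" l "b i"] t b fact[of i] by (simp add: mult.commute)
  qed
  then have "log_exponents TYPE('k) S S' s \<beta> = b"
    by (rule ext)
  moreover have "rectangular_decomposition S s t \<beta> b"
    by unfold_locales
       (simp_all add: t b fact decompose numerical_semigroup_zero[OF S] numerical_semigroup_add[OF S]
         numerical_semigroup_nonneg[OF S] flip: wt_def, use unique in blast)
  ultimately show ?thesis by auto
qed

section \<open>Triangular form and determinant of 3 by 3 matrices\<close>

lemma ex_increasing_3:
  obtains u v w :: 3 where "u < v" "v < w" "UNIV = {u, v, w}"
proof -
  \<comment> \<open>In the type \<open>3\<close> the numeral 3 equals 0, so the usual order of 1, 2,
    3 cannot be presumed; every possible order is treated.\<close>
  have "(1 :: 3) \<noteq> 2" "(1 :: 3) \<noteq> 3" "(2 :: 3) \<noteq> 3"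
    by simp_all
  then consider "(1 :: 3) < 2" "(2 :: 3) < 3" | "(1 :: 3) < 3" "(3 :: 3) < 2" | "(2 :: 3) < 1" "(1 :: 3) < 3"
    | "(2 :: 3) < 3" "(3 :: 3) < 1" | "(3 :: 3) < 1" "(1 :: 3) < 2" | "(3 :: 3) < 2" "(2 :: 3) < 1"
    by (meson linorder_neqE)
  then show ?thesis
    by cases (rule that, assumption, assumption, auto simp: UNIV_3)+
qed

lemma triangular_permuted_3:
  fixes A :: "'a::zero ^ 3 ^ 3"
  assumes d: "a \<noteq> c" "d \<noteq> c" "a \<noteq> d" and zero: "A $ a $ c = 0" "A $ d $ c = 0" "A $ d $ a = 0"
  shows "\<exists>\<pi>. \<pi> permutes UNIV \<and> triangular (\<chi> i j. A $ \<pi> i $ \<pi> j)"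
proof -
  obtain u v w :: 3 where uvw: "u < v" "v < w" "UNIV = {u, v, w}"
    by (rule ex_increasing_3)
  have cases: "x = u \<or> x = v \<or> x = w" for x
    using UNIV_I[of x] unfolding uvw(3) by simp
  \<comment> \<open>The order \<open>c, a, d\<close> puts the three known zeros below the
    diagonal.\<close>
  define \<pi> where "\<pi> x = (if x = u then c else if x = v then a else d)" for x
  have \<pi>: "\<pi> u = c" "\<pi> v = a" "\<pi> w = d"
    using uvw by (auto simp: \<pi>_def)
  have "inj \<pi>"
  proof (rule injI)
    fix x y assume "\<pi> x = \<pi> y"
    then show "x = y"
      using cases[of x] cases[of y] d \<pi> by metis
  qed
  then have "\<pi> permutes UNIV"
    by (rule inj_imp_permutes) simp_all
  moreover have "A $ \<pi> i $ \<pi> j = 0" if "j < i" for i j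
    using that cases[of i] cases[of j] uvw zero \<pi> by (auto dest: less_asym less_trans)
  ultimately show ?thesis
    unfolding triangular_def by auto
qed

text \<open>Every permutation other than the identity uses one of the three zero entries, so only
  the diagonal term of the determinant survives.\<close>

lemma det_triangular_3:
  fixes A :: "'a::comm_ring_1 ^ 3 ^ 3"
  assumes "a \<noteq> c" "d \<noteq> c" "a \<noteq> d" and "A $ a $ c = 0" "A $ d $ c = 0" "A $ d $ a = 0"
  shows "det A = A $ 1 $ 1 * A $ 2 $ 2 * A $ 3 $ 3"
  using exhaust_3[of a] exhaust_3[of c] exhaust_3[of d] assms by (auto simp: det_3)

theorem theorem5p1:
  fixes S S' :: "rat set" and s :: "3 \<Rightarrow> rat" and \<beta> :: "3 \<Rightarrow> nat"
  assumes "numerical_semigroup S" and "numerical_semigroup S'" and "S \<subseteq> S'"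
    and "S' = monoid_span (S \<union> range s)"
    and "flat_module (semigroup_ring S) (semigroup_algebra S' :: (rat \<Rightarrow> 'k::field, rat \<Rightarrow> 'k) module)"
    and "inj s"
    and "minimal_monomials S S' = range (\<lambda>i. umonom (s i) :: rat \<Rightarrow> 'k)"
    and "apery_rectangle TYPE('k) S S' s \<beta>"
  shows "(\<exists>\<pi>. \<pi> permutes UNIV \<and>
            triangular (\<chi> i j. log_matrix TYPE('k) S S' s \<beta> $ \<pi> i $ \<pi> j))
         \<and> det (log_matrix TYPE('k) S S' s \<beta>) \<noteq> 0"
proof -
  let ?b = "log_exponents TYPE('k) S S' s \<beta>" and ?A = "log_matrix TYPE('k) S S' s \<beta>"
  have "s i \<in> S'" for i
    using assms(4) by (simp add: monoid_span.incl)
  then obtain t where "rectangular_decomposition S s t \<beta> ?b"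
    using rectangular_decomposition_log_exponents[OF assms(1-3) _ assms(5,8)] by blast
  then interpret rectangular_decomposition_3 S s t \<beta> ?b "\<lambda>l. \<Sum>i\<in>UNIV. of_nat (l i) * s i"
    by (simp add: rectangular_decomposition_3_def)
  obtain a d c where d: "a \<noteq> c" "d \<noteq> c" "a \<noteq> d" and "?b a c = 0" "?b d c = 0" "?b d a = 0"
    by (rule ex_acyclic_order)
  then have zero: "?A $ a $ c = 0" "?A $ d $ c = 0" "?A $ d $ a = 0"
    by (auto simp: log_matrix_def)
  have "det ?A = int (\<beta> 1) * int (\<beta> 2) * int (\<beta> 3)"
    by (simp add: det_triangular_3[OF d zero]) (simp add: log_matrix_def)
  then show ?thesis
    using triangular_permuted_3[OF d zero] \<beta>_pos by simp
qed

end
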